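(* Let $B$ be a closed densely defined operator on an infinite dimensional complex Hilbert space $H$ and suppose that for one complex number $\lambda_0$, $(B-\lambda_0 I)$ is invertible and $(B-\lambda_0 I)^{-1}$ is upper triangular compact (with respect to some finite direct sum decomposition of $H$). Then the spectrum of $B$ consists of a (possibly empty) discrete set of eigenvalues with finite dimensional generalized eigenspaces.
   Context: Let $R$ be a bounded operator on a Hilbert space $H$ having a decomposition into a direct sum $H=\bigoplus_{j=1}^n H_j$ (closed subspaces). $R$ is called upper triangular compact (UTC) with respect to this decomposition if, in the corresponding block decomposition $R=(R_{jk})_{j,k=1}^n$ with $R_{jk}:H_k\to H_j$, the upper triangular blocks including the diagonal (i.e. $R_{jk}$ with $j\le k$) are compact; no condition beyond boundedness is imposed on the blocks with $j>k$. The generalized eigenspace of $B$ at an eigenvalue $\tau$ is $\bigcup_{k\ge1}\ker(B-\tau I)^k$. "Discrete" means without accumulation points in $\mathbb{C}$. *)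

theory Defs
  imports "HOL-Analysis.Analysis"
begin

section \<open>Complex Hilbert spaces\<close>

text \<open>The inner product is linear in the first argument. Real scaling is tied to complex
  scaling by \<open>scaleR_scaleC\<close>, so that the underlying real normed space is the restriction of
  scalars.\<close>

class complex_hilbert_space = real_normed_vector + complete_space +
  fixes scaleC :: "complex \<Rightarrow> 'a \<Rightarrow> 'a" (infixr "*\<^sub>C" 75)
    and cinner :: "'a \<Rightarrow> 'a \<Rightarrow> complex"
  assumes scaleR_scaleC: "scaleR r x = complex_of_real r *\<^sub>C x"
    and scaleC_add_right: "a *\<^sub>C (x + y) = a *\<^sub>C x + a *\<^sub>C y"
    and scaleC_add_left: "(a + b) *\<^sub>C x = a *\<^sub>C x + b *\<^sub>C x"
    and scaleC_scaleC: "a *\<^sub>C (b *\<^sub>C x) = (a * b) *\<^sub>C x"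
    and scaleC_one: "1 *\<^sub>C x = x"
    and cinner_commute: "cinner x y = cnj (cinner y x)"
    and cinner_add_left: "cinner (x + y) z = cinner x z + cinner y z"
    and cinner_scaleC_left: "cinner (a *\<^sub>C x) y = a * cinner x y"
    and cinner_self_eq_norm: "cinner x x = complex_of_real ((norm x)\<^sup>2)"

global_interpretation complex_vector:
  vector_space "scaleC :: complex \<Rightarrow> 'a \<Rightarrow> 'a::complex_hilbert_space"
  by unfold_locales
    (simp_all add: scaleC_add_right scaleC_add_left scaleC_scaleC scaleC_one)

definition cfinite_dim :: "'a::complex_hilbert_space set \<Rightarrow> bool" where
  "cfinite_dim V \<longleftrightarrow> (\<exists>S. finite S \<and> complex_vector.span S = V)"

definition bounded_clinear :: "('a::complex_hilbert_space \<Rightarrow> 'a) \<Rightarrow> bool" where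
  "bounded_clinear R \<longleftrightarrow> bounded_linear R \<and> (\<forall>c x. R (c *\<^sub>C x) = c *\<^sub>C R x)"

section \<open>Upper triangular compact operators\<close>

text \<open>A direct sum decomposition into closed subspaces \<open>H 1, \<dots>, H n\<close>, not required to be
  orthogonal.\<close>

definition direct_sum_decomp :: "nat \<Rightarrow> (nat \<Rightarrow> 'a::complex_hilbert_space set) \<Rightarrow> bool" where
  "direct_sum_decomp n H \<longleftrightarrow>
     (\<forall>j\<in>{1..n}. complex_vector.subspace (H j) \<and> closed (H j)) \<and>
     (\<forall>x. \<exists>!f. f \<in> (\<Pi>\<^sub>E j\<in>{1..n}. H j) \<and> x = (\<Sum>j\<in>{1..n}. f j))"

definition component :: "nat \<Rightarrow> (nat \<Rightarrow> 'a::complex_hilbert_space set) \<Rightarrow> nat \<Rightarrow> 'a \<Rightarrow> 'a" where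
  "component n H j x =
     (THE f. f \<in> (\<Pi>\<^sub>E i\<in>{1..n}. H i) \<and> x = (\<Sum>i\<in>{1..n}. f i)) j"

text \<open>The block \<open>R\<^sub>j\<^sub>k : H k \<rightarrow> H j\<close> is represented by a function on the whole space that is
  only meaningful on \<open>H k\<close>.\<close>

definition block ::
    "nat \<Rightarrow> (nat \<Rightarrow> 'a::complex_hilbert_space set) \<Rightarrow> ('a \<Rightarrow> 'a) \<Rightarrow> nat \<Rightarrow> nat \<Rightarrow> 'a \<Rightarrow> 'a" where
  "block n H R j k x = component n H j (R x)"

definition compact_map_on :: "'a::complex_hilbert_space set \<Rightarrow> ('a \<Rightarrow> 'a) \<Rightarrow> bool" where
  "compact_map_on S T \<longleftrightarrow> (\<forall>X. X \<subseteq> S \<longrightarrow> bounded X \<longrightarrow> compact (closure (T ` X)))"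

definition upper_triangular_compact ::
    "nat \<Rightarrow> (nat \<Rightarrow> 'a::complex_hilbert_space set) \<Rightarrow> ('a \<Rightarrow> 'a) \<Rightarrow> bool" where
  "upper_triangular_compact n H R \<longleftrightarrow>
     bounded_clinear R \<and> direct_sum_decomp n H \<and>
     (\<forall>j\<in>{1..n}. \<forall>k\<in>{1..n}. j \<le> k \<longrightarrow> compact_map_on (H k) (block n H R j k))"

section \<open>Unbounded operators\<close>

text \<open>An unbounded operator is given by its domain \<open>D\<close> and a function \<open>B\<close>, whose values outside
  \<open>D\<close> are irrelevant.\<close>

definition linear_operator :: "'a::complex_hilbert_space set \<Rightarrow> ('a \<Rightarrow> 'a) \<Rightarrow> bool" where
  "linear_operator D B \<longleftrightarrow>
     complex_vector.subspace D \<and>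
     (\<forall>x\<in>D. \<forall>y\<in>D. B (x + y) = B x + B y) \<and>
     (\<forall>c. \<forall>x\<in>D. B (c *\<^sub>C x) = c *\<^sub>C B x)"

definition closed_operator :: "'a::complex_hilbert_space set \<Rightarrow> ('a \<Rightarrow> 'a) \<Rightarrow> bool" where
  "closed_operator D B \<longleftrightarrow> closed ((\<lambda>x. (x, B x)) ` D)"

definition densely_defined :: "'a::complex_hilbert_space set \<Rightarrow> bool" where
  "densely_defined D \<longleftrightarrow> closure D = UNIV"

definition shift :: "('a::complex_hilbert_space \<Rightarrow> 'a) \<Rightarrow> complex \<Rightarrow> 'a \<Rightarrow> 'a" where
  "shift B \<tau> x = B x - \<tau> *\<^sub>C x"

definition resolvent ::
    "'a::complex_hilbert_space set \<Rightarrow> ('a \<Rightarrow> 'a) \<Rightarrow> complex \<Rightarrow> 'a \<Rightarrow> 'a" where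
  "resolvent D B \<tau> = inv_into D (shift B \<tau>)"

definition resolvent_set ::
    "'a::complex_hilbert_space set \<Rightarrow> ('a \<Rightarrow> 'a) \<Rightarrow> complex set" where
  "resolvent_set D B =
     {\<tau>. bij_betw (shift B \<tau>) D UNIV \<and> bounded_clinear (resolvent D B \<tau>)}"

definition spectrum :: "'a::complex_hilbert_space set \<Rightarrow> ('a \<Rightarrow> 'a) \<Rightarrow> complex set" where
  "spectrum D B = - resolvent_set D B"

definition eigenvalue ::
    "'a::complex_hilbert_space set \<Rightarrow> ('a \<Rightarrow> 'a) \<Rightarrow> complex \<Rightarrow> bool" where
  "eigenvalue D B \<tau> \<longleftrightarrow> (\<exists>x\<in>D. x \<noteq> 0 \<and> B x = \<tau> *\<^sub>C x)"

text \<open>The domain of \<open>(B - \<tau> I)\<^sup>k\<close> consists of the \<open>x\<close> for which all of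
  \<open>x, (B - \<tau> I) x, \<dots>, (B - \<tau> I)\<^sup>k\<^sup>-\<^sup>1 x\<close> lie in \<open>D\<close>.\<close>

definition ker_power ::
    "'a::complex_hilbert_space set \<Rightarrow> ('a \<Rightarrow> 'a) \<Rightarrow> complex \<Rightarrow> nat \<Rightarrow> 'a set" where
  "ker_power D B \<tau> k =
     {x. (\<forall>i<k. (shift B \<tau> ^^ i) x \<in> D) \<and> (shift B \<tau> ^^ k) x = 0}"

definition generalized_eigenspace ::
    "'a::complex_hilbert_space set \<Rightarrow> ('a \<Rightarrow> 'a) \<Rightarrow> complex \<Rightarrow> 'a set" where
  "generalized_eigenspace D B \<tau> = (\<Union>k\<in>{1..}. ker_power D B \<tau> k)"

end

theory Submission
  imports Defs
begin

text \<open>Let \<open>R = (B - \<mu> I)\<^sup>-\<^sup>1\<close> with coordinate projections \<open>P\<^sub>1, \<dots>, P\<^sub>n\<close>. By induction on \<open>i\<close>,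
  \<open>P\<^sub>j R\<^sup>i\<close> is compact for \<open>j \<le> i\<close>: in \<open>P\<^sub>j R\<^sup>i\<^sup>+\<^sup>1 = (\<Sum>k. P\<^sub>j R P\<^sub>k R\<^sup>i)\<close> the terms with \<open>k \<ge> j\<close>
  contain a compact block and the others contain \<open>P\<^sub>k R\<^sup>i\<close> with \<open>k \<le> i\<close>. Hence \<open>R\<^sup>n\<close> is compact, and
  Riesz theory applies to \<open>I - (\<tau> - \<mu>) R\<close>, since \<open>I - S\<close> divides \<open>I - S\<^sup>n\<close>. Each statement of that
  theory comes from the impossibility of an infinite flag of closed subspaces on whose steps the
  compact operator acts as a scalar bounded away from \<open>0\<close>. Boundedness of the \<open>P\<^sub>j\<close> is a consequence
  of the Baire category theorem.\<close>

section \<open>Projections of a direct sum decomposition\<close>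

instance complex_hilbert_space \<subseteq> banach ..

text \<open>Zabreiko's lemma. It is used instead of the closed graph theorem because the product of the
  summands of a direct sum decomposition is not a type.\<close>

theorem countably_subadditive_seminorm_bounded:
  fixes N :: "'a::banach \<Rightarrow> real"
  assumes nonneg: "\<And>x. 0 \<le> N x"
    and scale: "\<And>r x. N (r *\<^sub>R x) = \<bar>r\<bar> * N x"
    and add: "\<And>x y. N (x + y) \<le> N x + N y"
    and sums: "\<And>a x. a sums x \<Longrightarrow> summable (\<lambda>i. N (a i)) \<Longrightarrow> N x \<le> (\<Sum>i. N (a i))"
  shows "\<exists>C. \<forall>x. N x \<le> C * norm x"
proof -
  \<comment> \<open>The sublevel sets cover the space because \<open>N\<close> is finite everywhere,
    so by Baire the closure of one of them contains a ball.\<close>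
  define A where "A m = {x. N x \<le> real m}" for m
  have uni: "(\<Union>m. closure (A m)) = UNIV"
  proof -
    have "\<exists>m. x \<in> A m" for x
      using real_arch_simple[of "N x"] by (auto simp: A_def)
    then show ?thesis using closure_subset by fast
  qed
  have "\<exists>m. interior (closure (A m)) \<noteq> {}"
  proof (rule ccontr)
    assume "\<not> ?thesis"
    then have "Met_TC.mtopology interior_of (\<Union>(range (\<lambda>m. closure (A m)))) = {}"
      by (intro Met_TC.metric_Baire_category_alt) (auto simp: complete_UNIV)
    then show False using uni by simp
  qed
  then obtain m x0 r where r: "r > 0" and ball: "ball x0 r \<subseteq> closure (A m)"
    by (meson ex_in_conv mem_interior)
  have neg: "N (- x) = N x" for x using scale[of "-1" x] by simp
  \<comment> \<open>Symmetrization moves the ball from \<open>x0\<close> to the origin: with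
    \<open>a\<close> close to \<open>x0 + u\<close> and \<open>b\<close> close to
    \<open>x0 - u\<close>, half of \<open>a - b\<close> is close to \<open>u\<close>, and it stays
    in the sublevel set, which is convex and symmetric.\<close>
  have approx0: "\<exists>a. N a \<le> m \<and> norm (u - a) < e" if u: "norm u < r" and e: "e > 0" for u e
  proof -
    have "x0 + u \<in> closure (A m)" "x0 - u \<in> closure (A m)"
      using ball u by (auto simp: subset_iff dist_norm)
    then obtain a b where a: "a \<in> A m" "dist a (x0 + u) < e" and b: "b \<in> A m" "dist b (x0 - u) < e"
      using e unfolding closure_approachable by blast
    let ?c = "(1/2) *\<^sub>R (a + - b)"
    have "N ?c = (1/2) * N (a + - b)" using scale[of "1/2"] by simp
    also have "\<dots> \<le> m" using add[of a "-b"] a(1) b(1) neg[of b] by (auto simp: A_def)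
    finally have 1: "N ?c \<le> m" .
    have "u - ?c = (1/2) *\<^sub>R ((b - (x0 - u)) - (a - (x0 + u)))"
      by (simp add: algebra_simps flip: scaleR_add_left)
    then have "norm (u - ?c) = (1/2) * norm ((b - (x0 - u)) - (a - (x0 + u)))"
      by simp
    also have "\<dots> \<le> (1/2) * (norm (b - (x0 - u)) + norm (a - (x0 + u)))"
      by (intro mult_left_mono norm_triangle_ineq4) auto
    also have "\<dots> < e" using a(2) b(2) by (simp add: dist_norm)
    finally show ?thesis using 1 by blast
  qed
  \<comment> \<open>Rescaling \<open>approx0\<close> by \<open>t\<close>, with error
    \<open>r / 2\<close> there, leaves a remainder of half the permitted size, ready for the next
    round.\<close>
  have approx: "\<exists>a. N a \<le> m * t \<and> norm (u - a) < r * (t / 2)" if u: "norm u < r * t" and t: "t > 0" for u and t :: real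
  proof -
    have "norm ((1/t) *\<^sub>R u) < r" using u t by (simp add: field_simps)
    then obtain a where a: "N a \<le> m" "norm ((1/t) *\<^sub>R u - a) < r / 2"
      using approx0[of "(1/t) *\<^sub>R u" "r/2"] r by auto
    have "u - t *\<^sub>R a = t *\<^sub>R ((1/t) *\<^sub>R u - a)" using t by (simp add: algebra_simps)
    then have "norm (u - t *\<^sub>R a) = t * norm ((1/t) *\<^sub>R u - a)" using t by simp
    also have "\<dots> < t * (r / 2)" using a(2) t by simp
    finally have "norm (u - t *\<^sub>R a) < r * (t / 2)" by (simp add: mult.commute)
    moreover have "N (t *\<^sub>R a) \<le> m * t" using a(1) t scale[of t a] by (simp add: mult.commute)
    ultimately show ?thesis by blast
  qed
  have bound: "N x \<le> 2 * m" if x: "norm x < r" for x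
  proof -
    \<comment> \<open>Here \<open>y n\<close> is what remains of \<open>x\<close> after
      \<open>n\<close> approximations. The clause for \<open>n = 0\<close> records the starting
      point, on which the later telescoping depends.\<close>
    have "\<exists>y. \<forall>n. (norm (y n) < r * (1/2)^n \<and> (n = 0 \<longrightarrow> y n = x)) \<and> N (y n - y (Suc n)) \<le> m * (1/2)^n"
    proof (rule dependent_nat_choice)
      show "\<exists>y. norm y < r * (1/2)^0 \<and> (0 = (0::nat) \<longrightarrow> y = x)" using x by auto
    next
      fix u :: 'a and n :: nat
      assume "norm u < r * (1/2)^n \<and> (n = 0 \<longrightarrow> u = x)"
      then obtain a where "N a \<le> m * (1/2)^n" "norm (u - a) < r * ((1/2)^n / 2)"
        using approx[of u "(1/2)^n"] by auto
      then show "\<exists>y. (norm y < r * (1/2)^Suc n \<and> (Suc n = 0 \<longrightarrow> y = x)) \<and> N (u - y) \<le> m * (1/2)^n"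
        by (intro exI[of _ "u - a"]) auto
    qed
    then obtain y where y: "\<And>n. norm (y n) < r * (1/2)^n" "y 0 = x"
      "\<And>n. N (y n - y (Suc n)) \<le> m * (1/2)^n" by blast
    have "(\<lambda>n. r * (1/2)^n) \<longlonglongrightarrow> r * 0"
      by (intro tendsto_mult tendsto_const LIMSEQ_power_zero) auto
    then have "y \<longlonglongrightarrow> 0"
      by (intro Lim_null_comparison[where f=y and g="\<lambda>n. r * (1/2)^n"] always_eventually allI)
         (use y(1) less_imp_le in auto)
    then have sm: "(\<lambda>n. y n - y (Suc n)) sums x"
      using telescope_sums'[of y 0] y(2) by simp
    have geo: "(\<lambda>n. real m * (1/2)^n) sums (m * 2)"
      using sums_mult[OF geometric_sums[of "1/2::real"], of m] by simp
    have su: "summable (\<lambda>n. N (y n - y (Suc n)))"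
      by (rule summable_comparison_test'[OF sums_summable[OF geo], of 0]) (use y(3) nonneg in auto)
    \<comment> \<open>The removed pieces sum to \<open>x\<close>, so countable subadditivity bounds
      \<open>N x\<close> by a geometric series with sum \<open>2 * m\<close>.\<close>
    have "N x \<le> (\<Sum>n. N (y n - y (Suc n)))" by (rule sums[OF sm su])
    also have "\<dots> \<le> m * 2"
      using suminf_le[OF _ su sums_summable[OF geo]] y(3) sums_unique[OF geo] by simp
    finally show ?thesis by simp
  qed
  have "N x \<le> (4 * m / r) * norm x" for x
  proof (cases "x = 0")
    case True
    then show ?thesis using scale[of 0 x] by simp
  next
    case False
    \<comment> \<open>Scaling to norm \<open>r / 2\<close> puts the vector strictly inside the ball,
      which produces the constant \<open>4 * m / r\<close>.\<close>
    let ?s = "r / (2 * norm x)"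
    have s: "?s > 0" using r False by simp
    have "norm (?s *\<^sub>R x) < r" using r False by simp
    from bound[OF this] have "?s * N x \<le> 2 * m" using scale[of ?s x] r by simp
    then show ?thesis using r False by (simp add: field_simps)
  qed
  then show ?thesis by blast
qed

section \<open>Boundedness of the coordinate projections\<close>

context
  fixes n :: nat and H :: "nat \<Rightarrow> 'a::complex_hilbert_space set"
  assumes decomp: "direct_sum_decomp n H"
begin

lemma component_PiE:
  "(\<lambda>j\<in>{1..n}. component n H j x) \<in> (\<Pi>\<^sub>E j\<in>{1..n}. H j) \<and> x = (\<Sum>j\<in>{1..n}. component n H j x)"
proof -
  let ?P = "\<lambda>f. f \<in> (\<Pi>\<^sub>E i\<in>{1..n}. H i) \<and> x = (\<Sum>i\<in>{1..n}. f i)"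
  have "\<exists>!f. ?P f" using decomp by (auto simp: direct_sum_decomp_def)
  then have *: "?P (The ?P)" by (rule theI')
  define g where "g = The ?P"
  have g: "g \<in> (\<Pi>\<^sub>E i\<in>{1..n}. H i)" "x = (\<Sum>i\<in>{1..n}. g i)"
    using * unfolding g_def by blast+
  have "component n H j x = g j" for j
    unfolding component_def g_def ..
  then show ?thesis using g by simp
qed

lemma component_in: "j \<in> {1..n} \<Longrightarrow> component n H j x \<in> H j"
  using component_PiE[of x] by (auto simp: PiE_iff)

lemma sum_component: "(\<Sum>j\<in>{1..n}. component n H j x) = x"
  using component_PiE[of x] by simp

text \<open>The tool for computing components: any candidate family in the summands with the right
  sum must agree with them. Restricting \<open>f\<close> makes it extensional, as the definition of
  \<open>component\<close> demands.\<close>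

lemma component_unique:
  assumes "\<And>i. i \<in> {1..n} \<Longrightarrow> f i \<in> H i" "x = (\<Sum>i\<in>{1..n}. f i)" "j \<in> {1..n}"
  shows "component n H j x = f j"
proof -
  let ?P = "\<lambda>f. f \<in> (\<Pi>\<^sub>E i\<in>{1..n}. H i) \<and> x = (\<Sum>i\<in>{1..n}. f i)"
  have "\<exists>!f. ?P f" using decomp by (auto simp: direct_sum_decomp_def)
  moreover have "?P (restrict f {1..n})" using assms by auto
  moreover have "?P (\<lambda>j\<in>{1..n}. component n H j x)" using component_PiE by simp
  ultimately have "restrict f {1..n} = (\<lambda>j\<in>{1..n}. component n H j x)" by blast
  then have "restrict f {1..n} j = (\<lambda>j\<in>{1..n}. component n H j x) j" by simp
  then show ?thesis using assms(3) by simp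
qed

lemma component_subspace: "j \<in> {1..n} \<Longrightarrow> complex_vector.subspace (H j)"
  and component_closed: "j \<in> {1..n} \<Longrightarrow> closed (H j)"
  using decomp by (auto simp: direct_sum_decomp_def)

lemma component_add:
  assumes "j \<in> {1..n}"
  shows "component n H j (x + y) = component n H j x + component n H j y"
  by (rule component_unique[OF _ _ assms])
     (auto simp: sum.distrib sum_component simp del: One_nat_def intro!: complex_vector.subspace_add component_subspace component_in)

lemma component_scaleC:
  assumes "j \<in> {1..n}"
  shows "component n H j (c *\<^sub>C x) = c *\<^sub>C component n H j x"
  by (rule component_unique[OF _ _ assms])
     (auto simp: sum_component simp del: One_nat_def simp flip: complex_vector.scale_sum_right
        intro!: complex_vector.subspace_scale component_subspace component_in)

lemma component_scaleR: "j \<in> {1..n} \<Longrightarrow> component n H j (r *\<^sub>R x) = r *\<^sub>R component n H j x"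
  by (simp add: scaleR_scaleC component_scaleC)

text \<open>Zabreiko's lemma is applied to the sum of the norms of all components. If these are
  summable along a series, completeness makes each component series converge, closedness of
  \<open>H k\<close> keeps its limit in \<open>H k\<close>, and uniqueness identifies the limits
  with the components of the sum.\<close>

lemma bounded_linear_component:
  assumes j: "j \<in> {1..n}"
  shows "bounded_linear (component n H j)"
proof -
  let ?N = "\<lambda>x. \<Sum>i\<in>{1..n}. norm (component n H i x)"
  have "\<exists>C. \<forall>x. ?N x \<le> C * norm x"
  proof (rule countably_subadditive_seminorm_bounded)
    fix a x assume ax: "a sums x" and su: "summable (\<lambda>i. ?N (a i))"
    have suk: "summable (\<lambda>i. norm (component n H k (a i)))" if "k \<in> {1..n}" for k
      by (rule summable_comparison_test'[OF su, of 0])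
         (use that in \<open>auto intro!: member_le_sum[where f="\<lambda>k. norm (component n H k (a _))"]\<close>)
    define f where "f k = (\<Sum>i. component n H k (a i))" for k
    have f: "(\<lambda>i. component n H k (a i)) sums f k" if "k \<in> {1..n}" for k
      unfolding f_def by (rule summable_sums[OF summable_norm_cancel[OF suk[OF that]]])
    have fH: "f k \<in> H k" if "k \<in> {1..n}" for k
      using f[OF that] component_closed[OF that] unfolding sums_def
      by (rule Lim_in_closed_set[rotated 3])
         (auto intro!: always_eventually complex_vector.subspace_sum component_subspace component_in that)
    have "(\<lambda>i. \<Sum>k\<in>{1..n}. component n H k (a i)) sums (\<Sum>k\<in>{1..n}. f k)"
      by (intro sums_sum f)
    then have "x = (\<Sum>k\<in>{1..n}. f k)" unfolding sum_component using ax sums_unique2 by blast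
    then have eq: "component n H k x = f k" if "k \<in> {1..n}" for k
      using component_unique fH that by blast
    have "?N x = (\<Sum>k\<in>{1..n}. norm (f k))" by (simp add: eq)
    also have "\<dots> \<le> (\<Sum>k\<in>{1..n}. \<Sum>i. norm (component n H k (a i)))"
      unfolding f_def by (intro sum_mono summable_norm suk)
    also have "\<dots> = (\<Sum>i. ?N (a i))" by (intro suminf_sum[symmetric] suk)
    finally show "?N x \<le> (\<Sum>i. ?N (a i))" .
  next
    fix x y show "?N (x + y) \<le> ?N x + ?N y"
      by (simp add: component_add norm_triangle_ineq sum_mono flip: sum.distrib)
  qed (auto simp: sum_nonneg component_scaleR sum_distrib_left)
  then obtain C where C: "\<And>x. ?N x \<le> C * norm x" by blast
  have "norm (component n H j x) \<le> norm x * C" for x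
    using member_le_sum[of j "{1..n}" "\<lambda>k. norm (component n H k x)"] C[of x] j
    by (simp add: mult.commute)
  then show ?thesis
    by (intro bounded_linear_intro) (auto simp: component_add[OF j] component_scaleR[OF j])
qed

end

section \<open>Compactness of a power\<close>

lemma compact_map_onI:
  assumes "\<And>X. X \<subseteq> S \<Longrightarrow> bounded X \<Longrightarrow> \<exists>K. compact K \<and> T ` X \<subseteq> K"
  shows "compact_map_on S T"
  unfolding compact_map_on_def
proof (intro allI impI)
  fix X assume "X \<subseteq> S" "bounded X"
  then obtain K where K: "compact K" "T ` X \<subseteq> K" using assms by blast
  then have "closure (T ` X) = K \<inter> closure (T ` X)"
    using closure_minimal[of "T ` X" K] compact_imp_closed by auto
  then show "compact (closure (T ` X))"
    using compact_Int_closed[OF K(1) closed_closure] by metis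
qed

lemma compact_map_on_compose_bounded:
  assumes "compact_map_on S T" "bounded_linear f" "range f \<subseteq> S"
  shows "compact_map_on UNIV (\<lambda>x. T (f x))"
proof (rule compact_map_onI)
  fix X :: "'a set" assume "bounded X"
  then have "bounded (f ` X)" "f ` X \<subseteq> S"
    using assms bounded_linear_image[of X f] by auto
  then have "compact (closure (T ` f ` X))"
    using assms(1) unfolding compact_map_on_def by blast
  moreover have "(\<lambda>x. T (f x)) ` X \<subseteq> closure (T ` f ` X)"
    using closure_subset[of "T ` f ` X"] by (simp add: image_image)
  ultimately show "\<exists>K. compact K \<and> (\<lambda>x. T (f x)) ` X \<subseteq> K"
    by blast
qed

lemma bounded_compose_compact_map_on:
  assumes "compact_map_on S T" "bounded_linear f"
  shows "compact_map_on S (\<lambda>x. f (T x))"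
proof (rule compact_map_onI)
  fix X assume X: "X \<subseteq> S" "bounded X"
  have "compact (f ` closure (T ` X))"
    using assms X by (intro compact_continuous_image linear_continuous_on) (auto simp: compact_map_on_def)
  moreover have "(\<lambda>x. f (T x)) ` X \<subseteq> f ` closure (T ` X)"
    using closure_subset[of "T ` X"] by auto
  ultimately show "\<exists>K. compact K \<and> (\<lambda>x. f (T x)) ` X \<subseteq> K"
    by blast
qed

lemma compact_map_on_add:
  assumes "compact_map_on S f" "compact_map_on S g"
  shows "compact_map_on S (\<lambda>x. f x + g x)"
proof (rule compact_map_onI)
  fix X assume X: "X \<subseteq> S" "bounded X"
  let ?F = "closure (f ` X)" and ?G = "closure (g ` X)"
  have "compact {x + y | x y. x \<in> ?F \<and> y \<in> ?G}"
    using assms X by (intro compact_sums) (auto simp: compact_map_on_def)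
  moreover have "(\<lambda>x. f x + g x) ` X \<subseteq> {x + y | x y. x \<in> ?F \<and> y \<in> ?G}"
    using closure_subset[of "f ` X"] closure_subset[of "g ` X"] by blast
  ultimately show "\<exists>K. compact K \<and> (\<lambda>x. f x + g x) ` X \<subseteq> K"
    by blast
qed

lemma compact_map_on_zero: "compact_map_on S (\<lambda>x. 0)"
  by (rule compact_map_onI) (auto intro!: exI[of _ "{0}"])

lemma compact_map_on_sum:
  "(\<And>i. i \<in> I \<Longrightarrow> compact_map_on S (f i)) \<Longrightarrow> compact_map_on S (\<lambda>x. \<Sum>i\<in>I. f i x)"
  by (induction I rule: infinite_finite_induct) (auto simp: compact_map_on_zero compact_map_on_add)

lemma bounded_linear_funpow:
  "bounded_linear (f :: 'a \<Rightarrow> 'a::real_normed_vector) \<Longrightarrow> bounded_linear (f ^^ i)"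
proof (induction i)
  case 0
  then show ?case using bounded_linear_ident by (simp add: id_def)
next
  case (Suc i)
  then show ?case using bounded_linear_compose[of f "f ^^ i"] by (simp add: o_def)
qed

theorem upper_triangular_compact_power:
  assumes "upper_triangular_compact n H R"
  shows "compact_map_on UNIV (R ^^ n)"
proof -
  let ?P = "component n H"
  have R: "bounded_linear R" and H: "direct_sum_decomp n H"
    and blk: "\<And>j k. j \<in> {1..n} \<Longrightarrow> k \<in> {1..n} \<Longrightarrow> j \<le> k \<Longrightarrow> compact_map_on (H k) (block n H R j k)"
    using assms by (auto simp: upper_triangular_compact_def bounded_clinear_def)
  have comp: "compact_map_on UNIV (\<lambda>x. ?P j ((R ^^ i) x))" if "j \<in> {1..n}" "j \<le> i" for i j
    using that
  proof (induction i arbitrary: j)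
    \<comment> \<open>Vacuous, since component indices start at 1.\<close>
    case 0
    then show ?case by simp
  next
    case (Suc i)
    note P = bounded_linear_component[OF H] and pow = bounded_linear_funpow[OF R]
    have "compact_map_on UNIV (\<lambda>x. ?P j (R (?P k ((R ^^ i) x))))" if k: "k \<in> {1..n}" for k
    proof (cases "j \<le> k")
      case True
      have "compact_map_on UNIV (\<lambda>x. block n H R j k (?P k ((R ^^ i) x)))"
        by (rule compact_map_on_compose_bounded[OF blk])
           (use True k Suc.prems component_in[OF H k] bounded_linear_compose[OF P[OF k] pow] in auto)
      then show ?thesis by (simp add: block_def)
    next
      case False
      then have "compact_map_on UNIV (\<lambda>x. ?P k ((R ^^ i) x))" using Suc k by auto
      then show ?thesis
        by (rule bounded_compose_compact_map_on) (rule bounded_linear_compose[OF P[OF Suc.prems(1)] R])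
    qed
    then have "compact_map_on UNIV (\<lambda>x. \<Sum>k\<in>{1..n}. ?P j (R (?P k ((R ^^ i) x))))"
      by (rule compact_map_on_sum)
    moreover have "(\<Sum>k\<in>{1..n}. ?P j (R (?P k y))) = ?P j (R y)" for y
      using linear_sum[OF bounded_linear.linear[OF bounded_linear_compose[OF P[OF Suc.prems(1)] R]],
          of "\<lambda>k. ?P k y" "{1..n}"] unfolding sum_component[OF H] by (rule sym)
    ultimately show ?case by simp
  qed
  have "compact_map_on UNIV (\<lambda>x. \<Sum>j\<in>{1..n}. ?P j ((R ^^ n) x))"
    by (intro compact_map_on_sum comp) auto
  then show ?thesis unfolding sum_component[OF H] by simp
qed

section \<open>Flags of closed subspaces\<close>

lemma norm_scaleC: "norm (c *\<^sub>C x) = cmod c * norm x"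
proof -
  \<comment> \<open>The class relates the norm to complex scalars only through the inner product, so
    homogeneity is read off there.\<close>
  have "cinner (c *\<^sub>C x) (c *\<^sub>C x) = c * (cnj c * cinner x x)"
    by (metis cinner_commute cinner_scaleC_left complex_cnj_mult)
  then have "complex_of_real ((norm (c *\<^sub>C x))\<^sup>2) = complex_of_real ((cmod c * norm x)\<^sup>2)"
    by (simp add: cinner_self_eq_norm power_mult_distrib complex_norm_square[of c] mult.assoc del: of_real_power)
  then have "(norm (c *\<^sub>C x))\<^sup>2 = (cmod c * norm x)\<^sup>2"
    unfolding of_real_eq_iff .
  then show ?thesis by simp
qed

lemma bounded_linear_scaleC_right: "bounded_linear ((*\<^sub>C) c)"
  by (rule bounded_linear_intro[of _ "cmod c"])
     (auto simp: scaleC_add_right norm_scaleC scaleR_scaleC scaleC_scaleC mult.commute)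

lemma bounded_linear_scaleC_left: "bounded_linear (\<lambda>c. c *\<^sub>C x)"
  by (rule bounded_linear_intro[of _ "norm x"])
     (auto simp: scaleC_add_left norm_scaleC scaleR_scaleC scaleC_scaleC scaleR_conv_of_real)

text \<open>After division by \<open>k\<close> the vector \<open>w\<close> becomes the negative of a
  competitor in the infimum. Every separation estimate below uses this bound.\<close>

lemma infdist_subspace_le:
  assumes V: "complex_vector.subspace V" and w: "w \<in> V"
  shows "cmod k * infdist a V \<le> norm (k *\<^sub>C a + w)"
proof (cases "k = 0")
  case False
  let ?v = "- ((1/k) *\<^sub>C w)"
  have "?v \<in> V" using V w by (intro complex_vector.subspace_neg complex_vector.subspace_scale)
  then have "infdist a V \<le> norm (a - ?v)" using infdist_le[of ?v V a] by (simp add: dist_norm)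
  then have "cmod k * infdist a V \<le> norm (k *\<^sub>C (a - ?v))"
    by (simp add: norm_scaleC mult_left_mono)
  also have "k *\<^sub>C (a - ?v) = k *\<^sub>C a + w"
    using False by (simp add: scaleC_add_right scaleC_scaleC scaleC_one)
  finally show ?thesis .
qed simp

lemma infdist_pos:
  assumes "closed V" "complex_vector.subspace V" "a \<notin> V"
  shows "infdist a V > 0"
  using assms in_closed_iff_infdist_zero[of V a] infdist_nonneg[of a V] complex_vector.subspace_0[of V]
  by force

text \<open>Flags built from spans must consist of closed sets. When \<open>a\<close> is added, its
  positive distance to the old span controls the coefficient of \<open>a\<close>, so along a
  convergent sequence the coefficients are Cauchy and the remainders converge in the old
  span.\<close>

lemma closed_span_finite:
  assumes "finite S"
  shows "closed (complex_vector.span S)"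
  using assms
proof induction
  case empty
  then show ?case by simp
next
  case (insert a S)
  let ?V = "complex_vector.span S"
  note sub = complex_vector.subspace_span[of S]
  show ?case
  proof (cases "a \<in> ?V")
    case True
    then show ?thesis using insert by (simp add: complex_vector.span_redundant)
  next
    case False
    let ?d = "infdist a ?V"
    have d: "?d > 0" using infdist_pos insert False sub by blast
    show ?thesis unfolding closed_sequential_limits
    proof (intro allI impI, elim conjE)
      fix y l assume y: "\<forall>n. y n \<in> complex_vector.span (insert a S)" and lim: "y \<longlonglongrightarrow> l"
      have "\<forall>n. \<exists>k. y n - k *\<^sub>C a \<in> ?V" using y by (simp add: complex_vector.span_insert)
      then obtain k where k: "\<And>n. y n - k n *\<^sub>C a \<in> ?V" by metis
      have kd: "cmod (k i - k j) * ?d \<le> norm (y i - y j)" for i j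
      proof -
        have "cmod (k i - k j) * ?d
            \<le> norm ((k i - k j) *\<^sub>C a + ((y i - k i *\<^sub>C a) - (y j - k j *\<^sub>C a)))"
          by (intro infdist_subspace_le sub complex_vector.span_diff k)
        also have "(k i - k j) *\<^sub>C a + ((y i - k i *\<^sub>C a) - (y j - k j *\<^sub>C a)) = y i - y j"
          by (simp add: complex_vector.scale_left_diff_distrib)
        finally show ?thesis .
      qed
      have "Cauchy k"
      proof (rule metric_CauchyI)
        fix e :: real assume e: "e > 0"
        then obtain M where M: "\<And>i j. i \<ge> M \<Longrightarrow> j \<ge> M \<Longrightarrow> dist (y i) (y j) < e * ?d"
          using metric_CauchyD[OF LIMSEQ_imp_Cauchy[OF lim], of "e * ?d"] d by auto
        have "dist (k i) (k j) < e" if "i \<ge> M" "j \<ge> M" for i j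
        proof -
          have "dist (k i) (k j) * ?d < e * ?d"
            using kd[of i j] M[OF that] by (simp add: dist_norm)
          then show ?thesis using d by simp
        qed
        then show "\<exists>M. \<forall>i\<ge>M. \<forall>j\<ge>M. dist (k i) (k j) < e" by blast
      qed
      then obtain c where "k \<longlonglongrightarrow> c" using Cauchy_convergent convergentD by blast
      then have "(\<lambda>n. y n - k n *\<^sub>C a) \<longlonglongrightarrow> l - c *\<^sub>C a"
        by (intro tendsto_diff lim bounded_linear.tendsto[OF bounded_linear_scaleC_left])
      then have "l - c *\<^sub>C a \<in> ?V"
        by (rule Lim_in_closed_set[rotated 3]) (use k insert.IH in \<open>auto intro: always_eventually\<close>)
      then show "l \<in> complex_vector.span (insert a S)" by (auto simp: complex_vector.span_insert)
    qed
  qed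
qed

text \<open>Take \<open>v\<close> in \<open>V\<close> whose distance to \<open>x\<close> is less
  than twice the infimum and normalize \<open>x - v\<close>; the factor 2 becomes the bound
  \<open>1/2\<close>.\<close>

lemma Riesz_almost_orthogonal:
  assumes V: "complex_vector.subspace V" "closed V" and U: "complex_vector.subspace U" "V \<subseteq> U"
    and x: "x \<in> U" "x \<notin> V"
  shows "\<exists>y\<in>U. norm y \<le> 1 \<and> 1/2 \<le> infdist y V"
proof -
  have ne: "V \<noteq> {}" using complex_vector.subspace_0[OF V(1)] by blast
  let ?d = "infdist x V"
  have d: "?d > 0" using infdist_pos V x by blast
  have "\<exists>v\<in>V. dist x v < 2 * ?d"
  proof (rule ccontr)
    assume "\<not> ?thesis"
    then have "2 * ?d \<le> ?d"
      using ne unfolding infdist_notempty[OF ne] by (intro cINF_greatest) (auto simp: not_less)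
    then show False using d by simp
  qed
  then obtain v where v: "v \<in> V" "norm (x - v) < 2 * ?d" by (auto simp: dist_norm)
  let ?r = "norm (x - v)"
  have r: "?r > 0" using v x by auto
  let ?c = "complex_of_real (1 / ?r)"
  let ?y = "?c *\<^sub>C (x - v)"
  have "?y \<in> U" using U v x by (intro complex_vector.subspace_scale complex_vector.subspace_diff) auto
  moreover have "norm ?y \<le> 1" using r by (simp add: norm_scaleC norm_divide)
  moreover have "1/2 \<le> infdist ?y V"
    unfolding infdist_notempty[OF ne]
  proof (rule cINF_greatest[OF ne])
    fix w assume w: "w \<in> V"
    have "1/2 \<le> cmod ?c * ?d" using v(2) r by (simp add: field_simps norm_divide)
    also have "\<dots> \<le> norm (?c *\<^sub>C x + - (?c *\<^sub>C v + w))"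
      by (intro infdist_subspace_le V complex_vector.subspace_neg complex_vector.subspace_add
          complex_vector.subspace_scale v w)
    also have "\<dots> = dist ?y w"
      by (simp add: dist_norm complex_vector.scale_right_diff_distrib algebra_simps)
    finally show "1/2 \<le> dist ?y w" .
  qed
  ultimately show ?thesis by blast
qed

section \<open>Compactness against infinite flags\<close>

lemma compact_map_on_subsequence:
  fixes y :: "nat \<Rightarrow> 'a::complex_hilbert_space"
  assumes T: "compact_map_on UNIV T" and y: "bounded (range y)"
  shows "\<exists>l r. strict_mono (r :: nat \<Rightarrow> nat) \<and> (\<lambda>k. T (y (r k))) \<longlonglongrightarrow> l"
proof -
  have "seq_compact (closure (T ` range y))"
    using T y by (simp add: compact_map_on_def compact_imp_seq_compact del: image_image)
  moreover have "\<forall>k. T (y k) \<in> closure (T ` range y)"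
    using closure_subset[of "T ` range y"] by auto
  ultimately obtain l r where "strict_mono (r :: nat \<Rightarrow> nat)" "((\<lambda>k. T (y k)) \<circ> r) \<longlonglongrightarrow> l"
    by (rule seq_compactE)
  then show ?thesis by (auto simp: o_def)
qed

text \<open>Almost orthogonal vectors \<open>y k\<close> in \<open>U k\<close> have images at mutual
  distance at least \<open>\<delta> / 2\<close>: modulo \<open>V k\<close> the image of
  \<open>y k\<close> is \<open>c k\<close> times \<open>y k\<close>, while that of
  \<open>y l\<close> vanishes. So no subsequence of the images converges. The disjunction in
  \<open>off\<close> admits both increasing and decreasing flags.\<close>

lemma compact_map_no_infinite_flag:
  fixes U V :: "nat \<Rightarrow> 'a::complex_hilbert_space set"
  assumes T: "compact_map_on UNIV T"
    and V: "\<And>k. complex_vector.subspace (V k)" "\<And>k. closed (V k)"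
    and U: "\<And>k. complex_vector.subspace (U k)" "\<And>k. V k \<subset> U k"
    and diag: "\<And>k u. u \<in> U k \<Longrightarrow> T u - c k *\<^sub>C u \<in> V k"
    and c: "\<delta> > 0" "\<And>k. \<delta> \<le> cmod (c k)"
    and off: "\<And>k l. k \<noteq> l \<Longrightarrow> T ` U k \<subseteq> V l \<or> T ` U l \<subseteq> V k"
  shows False
proof -
  have "\<exists>y\<in>U k. norm y \<le> 1 \<and> 1/2 \<le> infdist y (V k)" for k
    using Riesz_almost_orthogonal[OF V U(1)] U(2)[of k] by blast
  then obtain y where y: "\<And>k. y k \<in> U k" "\<And>k. norm (y k) \<le> 1" "\<And>k. 1/2 \<le> infdist (y k) (V k)"
    by metis
  have sep1: "\<delta> / 2 \<le> norm (T (y k) - T (y l))" if "T ` U l \<subseteq> V k" for k l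
  proof -
    have "\<delta> / 2 \<le> cmod (c k) * infdist (y k) (V k)"
      using mult_mono[OF c(2) y(3)] c(1) by force
    also have "\<dots> \<le> norm (c k *\<^sub>C y k + ((T (y k) - c k *\<^sub>C y k) - T (y l)))"
      by (intro infdist_subspace_le V complex_vector.subspace_diff diag y) (use that y in auto)
    finally show ?thesis by simp
  qed
  have sep: "\<delta> / 2 \<le> dist (T (y k)) (T (y l))" if "k \<noteq> l" for k l
    using off[OF that] sep1 unfolding dist_norm by (metis norm_minus_commute)
  have "bounded (range y)" using y(2) by (auto simp: bounded_iff)
  then obtain l r where r: "strict_mono (r :: nat \<Rightarrow> nat)" "(\<lambda>k. T (y (r k))) \<longlonglongrightarrow> l"
    using compact_map_on_subsequence[OF T] by blast
  from LIMSEQ_imp_Cauchy[OF r(2)] obtain M where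
    "\<And>i j. i \<ge> M \<Longrightarrow> j \<ge> M \<Longrightarrow> dist (T (y (r i))) (T (y (r j))) < \<delta> / 2"
    using c(1) metric_CauchyD[of "\<lambda>k. T (y (r k))" "\<delta> / 2"] by auto
  from this[of M "Suc M"] have "dist (T (y (r M))) (T (y (r (Suc M)))) < \<delta> / 2" by simp
  moreover have "r M \<noteq> r (Suc M)" using strict_monoD[OF r(1), of M "Suc M"] by simp
  ultimately show False using sep[of "r M" "r (Suc M)"] by simp
qed

section \<open>Bounded complex linear maps\<close>

lemma bounded_clinearD:
  assumes "bounded_clinear R"
  shows "bounded_linear R" "R (x + y) = R x + R y" "R (x - y) = R x - R y"
    "R (c *\<^sub>C x) = c *\<^sub>C R x" "R 0 = 0"
  using assms bounded_linear.linear[of R]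
  by (auto simp: bounded_clinear_def linear_add linear_diff linear_0)

lemma bounded_clinear_funpow: "bounded_clinear R \<Longrightarrow> bounded_clinear (R ^^ i)"
proof (induction i)
  case (Suc i)
  then show ?case
    using bounded_linear_compose[of R "R ^^ i"] by (simp add: bounded_clinear_def o_def)
qed (simp add: bounded_clinear_def id_def bounded_linear_ident)

lemma bounded_clinear_id_minus: "bounded_clinear S \<Longrightarrow> bounded_clinear (\<lambda>x. x - S x)"
  by (auto simp: bounded_clinear_def complex_vector.scale_right_diff_distrib
      intro!: bounded_linear_sub bounded_linear_ident)

lemma bounded_clinear_scaleC: "bounded_clinear S \<Longrightarrow> bounded_clinear (\<lambda>x. c *\<^sub>C S x)"
  using bounded_linear_compose[OF bounded_linear_scaleC_right, of S c]
  by (auto simp: bounded_clinear_def scaleC_scaleC mult.commute)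

lemma subspace_image_clinear:
  assumes "bounded_clinear A" "complex_vector.subspace V"
  shows "complex_vector.subspace (A ` V)"
  unfolding complex_vector.subspace_def
proof (intro conjI ballI allI)
  show "0 \<in> A ` V" using assms complex_vector.subspace_0 bounded_clinearD(5) by (metis imageI)
next
  fix x y assume "x \<in> A ` V" "y \<in> A ` V"
  then obtain u v where "u \<in> V" "v \<in> V" "x = A u" "y = A v" by blast
  then show "x + y \<in> A ` V"
    using complex_vector.subspace_add[OF assms(2)] bounded_clinearD(2)[OF assms(1), of u v]
    by (intro image_eqI[of _ _ "u + v"]) auto
next
  fix c x assume "x \<in> A ` V"
  then obtain u where "u \<in> V" "x = A u" by blast
  then show "c *\<^sub>C x \<in> A ` V"
    using complex_vector.subspace_scale[OF assms(2)] bounded_clinearD(4)[OF assms(1), of c u]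
    by (intro image_eqI[of _ _ "c *\<^sub>C u"]) auto
qed

section \<open>Riesz theory for power compact operators\<close>

text \<open>A partial sum of the Neumann series, hence the cofactor of \<open>I - S\<close> in
  \<open>I - S ^^ m\<close>. It carries compactness of the power over to statements about
  \<open>I - S\<close>.\<close>

definition neumann_sum :: "('a \<Rightarrow> 'a) \<Rightarrow> nat \<Rightarrow> 'a \<Rightarrow> 'a::complex_hilbert_space" where
  "neumann_sum S m x = (\<Sum>i<m. (S ^^ i) x)"

context
  fixes S :: "'a::complex_hilbert_space \<Rightarrow> 'a" and m :: nat
  assumes S: "bounded_clinear S" and compact_power: "compact_map_on UNIV (S ^^ m)"
begin

lemma bounded_linear_neumann: "bounded_linear (neumann_sum S m)"
  unfolding neumann_sum_def
  by (intro bounded_linear_sum bounded_linear_funpow bounded_clinearD(1)[OF S])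

text \<open>This order of the factors puts values of \<open>I - S ^^ m\<close> into ranges of
  \<open>I - S\<close>; \<open>neumann_left\<close> is the version for recovering a vector from its
  image and for kernels.\<close>

lemma neumann_right: "neumann_sum S m x - S (neumann_sum S m x) = x - (S ^^ m) x"
proof -
  have "S (neumann_sum S m x) = (\<Sum>i<m. (S ^^ Suc i) x)"
    unfolding neumann_sum_def
    using linear_sum[OF bounded_linear.linear[OF bounded_clinearD(1)[OF S]]] by simp
  then show ?thesis
    using sum_lessThan_telescope'[of "\<lambda>i. (S ^^ i) x" m] by (simp add: neumann_sum_def sum_subtractf)
qed

lemma neumann_left: "neumann_sum S m (x - S x) = x - (S ^^ m) x"
proof -
  have "(S ^^ i) (x - S x) = (S ^^ i) x - (S ^^ Suc i) x" for i
    by (simp add: bounded_clinearD(3)[OF bounded_clinear_funpow[OF S]] funpow_swap1)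
  then show ?thesis
    using sum_lessThan_telescope'[of "\<lambda>i. (S ^^ i) x" m] by (simp add: neumann_sum_def)
qed

lemma neumann_invariant:
  assumes "complex_vector.subspace V" "S ` V \<subseteq> V" "x \<in> V"
  shows "(S ^^ i) x \<in> V" "neumann_sum S m x \<in> V"
proof -
  show "(S ^^ i) x \<in> V" for i using assms by (induction i) auto
  then show "neumann_sum S m x \<in> V"
    unfolding neumann_sum_def using assms(1) by (intro complex_vector.subspace_sum)
qed

text \<open>Otherwise there are unit vectors \<open>y k\<close> with \<open>y k - S (y k)\<close>
  tending to 0. By \<open>neumann_left\<close>, \<open>y k\<close> is the cofactor applied to this
  difference plus \<open>(S ^^ m) (y k)\<close>, so a subsequence converges, and its limit is a
  fixed vector of norm 1.\<close>

lemma id_minus_bounded_below: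
  assumes inj: "\<And>x. S x = x \<Longrightarrow> x = 0"
  shows "\<exists>e>0. \<forall>x. e * norm x \<le> norm (x - S x)"
proof (rule ccontr)
  let ?Q = "neumann_sum S m"
  assume "\<not> ?thesis"
  then have "\<exists>x. norm (x - S x) < inverse (real (Suc k)) * norm x" for k
    by (metis inverse_positive_iff_positive of_nat_0_less_iff zero_less_Suc not_le)
  then obtain x where x: "\<And>k. norm (x k - S (x k)) < inverse (real (Suc k)) * norm (x k)" by metis
  have pos: "norm (x k) > 0" for k using x[of k] bounded_clinearD(5)[OF S] by auto
  define y where "y k = complex_of_real (1 / norm (x k)) *\<^sub>C x k" for k
  have y1: "norm (y k) = 1" for k using pos[of k] by (simp add: y_def norm_scaleC norm_divide)
  have "y k - S (y k) = complex_of_real (1 / norm (x k)) *\<^sub>C (x k - S (x k))" for k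
    by (simp add: y_def bounded_clinearD(4)[OF S] complex_vector.scale_right_diff_distrib)
  then have "norm (y k - S (y k)) \<le> inverse (real (Suc k))" for k
    using x[of k] pos[of k] by (simp add: norm_scaleC norm_divide divide_simps mult.commute)
  then have lim0: "(\<lambda>k. y k - S (y k)) \<longlonglongrightarrow> 0"
    by (intro Lim_null_comparison[OF _ LIMSEQ_inverse_real_of_nat] always_eventually allI)
  have "bounded (range y)" using y1 by (auto simp: bounded_iff)
  then obtain l r where r: "strict_mono (r :: nat \<Rightarrow> nat)" "(\<lambda>k. (S ^^ m) (y (r k))) \<longlonglongrightarrow> l"
    using compact_map_on_subsequence[OF compact_power] by blast
  have lim0r: "(\<lambda>k. y (r k) - S (y (r k))) \<longlonglongrightarrow> 0"
    using LIMSEQ_subseq_LIMSEQ[OF lim0 r(1)] by (simp add: o_def)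
  have "(\<lambda>k. ?Q (y (r k) - S (y (r k))) + (S ^^ m) (y (r k))) \<longlonglongrightarrow> ?Q 0 + l"
    using r(2) by (intro tendsto_add bounded_linear.tendsto[OF bounded_linear_neumann] lim0r)
  then have yl: "(\<lambda>k. y (r k)) \<longlonglongrightarrow> l"
    using bounded_linear_neumann by (simp add: neumann_left linear_0 bounded_linear.linear)
  then have "(\<lambda>k. y (r k) - S (y (r k))) \<longlonglongrightarrow> l - S l"
    by (intro tendsto_diff bounded_linear.tendsto[OF bounded_clinearD(1)[OF S]])
  then have "l - S l = 0" using lim0r LIMSEQ_unique by blast
  then have "l = 0" using inj by (metis eq_iff_diff_eq_0)
  moreover have "norm l = 1"
    using tendsto_norm[OF yl] y1 LIMSEQ_unique[of "\<lambda>k. 1" "norm l" 1] by simp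
  ultimately show False by simp
qed

text \<open>If \<open>I - S\<close> were injective but not surjective, the ranges of its powers
  would form a strictly decreasing flag of closed subspaces, and \<open>S ^^ m\<close> acts as the
  identity on each quotient.\<close>

lemma Fredholm_alternative:
  assumes inj: "\<And>x. S x = x \<Longrightarrow> x = 0"
  shows "surj (\<lambda>x. x - S x)"
proof (rule ccontr)
  let ?A = "\<lambda>x. x - S x"
  assume "\<not> ?thesis"
  then obtain z where z: "z \<notin> range ?A" by blast
  obtain e where e: "e > 0" "\<And>x. e * norm x \<le> norm (?A x)" using id_minus_bounded_below inj by blast
  note A = bounded_clinear_id_minus[OF S]
  have injA: "inj ?A"
    using inj e by (intro injI) (metis bounded_clinearD(3)[OF A] eq_iff_diff_eq_0)
  define W where "W k = (?A ^^ k) ` UNIV" for k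
  have WSuc: "W (Suc k) = ?A ` W k" for k by (simp add: W_def image_comp)
  have sub: "complex_vector.subspace (W k)" for k
    unfolding W_def by (intro subspace_image_clinear bounded_clinear_funpow A complex_vector.subspace_UNIV)
  \<comment> \<open>A linear map bounded below sends complete subspaces to complete ones.\<close>
  have cl: "complete (W k)" for k
  proof (induction k)
    case 0
    then show ?case by (simp add: W_def complete_UNIV)
  next
    case (Suc k)
    have "subspace (W k)"
      unfolding subspace_def scaleR_scaleC
      using sub[of k] by (simp add: complex_vector.subspace_def)
    then show ?case unfolding WSuc
      by (rule complete_isometric_image[OF e(1) _ bounded_clinearD(1)[OF A]]) (use e Suc in auto)
  qed
  have dec: "W l \<subseteq> W k" if "k \<le> l" for k l
  proof
    fix x assume "x \<in> W l"
    then obtain u where "x = (?A ^^ l) u" by (auto simp: W_def)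
    then have "x = (?A ^^ k) ((?A ^^ (l - k)) u)" using that
      by (metis comp_apply funpow_add le_add_diff_inverse)
    then show "x \<in> W k" by (auto simp: W_def)
  qed
  \<comment> \<open>\<open>S u\<close> is the difference of \<open>u\<close> and
    \<open>?A u\<close>, both in \<open>W k\<close> since the ranges decrease.\<close>
  have inv: "S ` W k \<subseteq> W k" for k
  proof
    fix x assume "x \<in> S ` W k"
    then obtain u where u: "u \<in> W k" "x = S u" by blast
    have "u - S u \<in> W k" using u(1) WSuc[of k] dec[of k "Suc k"] by auto
    then have "u - (u - S u) \<in> W k" using complex_vector.subspace_diff[OF sub] u by blast
    then show "x \<in> W k" using u by simp
  qed
  have strict: "W (Suc k) \<subset> W k" for k
  proof -
    \<comment> \<open>Cancelling the injective power would place \<open>z\<close> in the range of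
      \<open>?A\<close>.\<close>
    have "(?A ^^ k) z \<notin> W (Suc k)"
    proof
      assume "(?A ^^ k) z \<in> W (Suc k)"
      then obtain u where "(?A ^^ k) z = (?A ^^ Suc k) u" unfolding W_def by blast
      then have "(?A ^^ k) z = (?A ^^ k) (?A u)" by (simp only: funpow_Suc_right comp_apply)
      then show False using z inj_fn[OF injA, of k] by (auto simp: inj_def)
    qed
    moreover have "(?A ^^ k) z \<in> W k" by (simp add: W_def)
    ultimately show ?thesis using dec[of k "Suc k"] by auto
  qed
  show False
  proof (rule compact_map_no_infinite_flag[OF compact_power, of "\<lambda>k. W (Suc k)" W "\<lambda>_. 1" 1])
    fix k u assume u: "u \<in> W k"
    \<comment> \<open>This vector is \<open>(S ^^ m) u - u\<close>, because \<open>I - S\<close>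
      divides \<open>I - S ^^ m\<close>; the invariance of \<open>W k\<close> keeps the cofactor
      inside.\<close>
    have "?A (- neumann_sum S m u) \<in> W (Suc k)"
      unfolding WSuc by (intro imageI complex_vector.subspace_neg sub neumann_invariant inv u)
    moreover have "?A (- neumann_sum S m u) = - (?A (neumann_sum S m u))"
      using linear_neg[OF bounded_linear.linear[OF bounded_clinearD(1)[OF A]]] by blast
    ultimately show "(S ^^ m) u - 1 *\<^sub>C u \<in> W (Suc k)"
      unfolding neumann_right by (simp add: scaleC_one)
  next
    fix k l :: nat assume "k \<noteq> l"
    have *: "(S ^^ m) ` W k \<subseteq> W (Suc l)" if "l < k" for k l
      using neumann_invariant(1)[OF sub inv, of _ k m] dec[of "Suc l" k] that by auto
    show "(S ^^ m) ` W k \<subseteq> W (Suc l) \<or> (S ^^ m) ` W l \<subseteq> W (Suc k)"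
      using *[of k l] *[of l k] \<open>k \<noteq> l\<close> nat_neq_iff[of k l] by blast
  qed (auto simp: sub strict complete_imp_closed[OF cl])
qed

text \<open>An infinite dimensional \<open>?G\<close> would contain an increasing chain of finite
  spans, each mapped by \<open>?A\<close> into its predecessor. By \<open>neumann_left\<close>,
  \<open>S ^^ m\<close> is then the identity on the quotients. This handles the dimension of the
  single kernels and their stabilization at once.\<close>

lemma generalized_kernel_finite_dim:
  "cfinite_dim {x. \<exists>k. ((\<lambda>x. x - S x) ^^ k) x = 0}" (is "cfinite_dim ?G")
proof (rule ccontr)
  let ?A = "\<lambda>x. x - S x" and ?span = complex_vector.span
  assume inf: "\<not> ?thesis"
  note A = bounded_clinear_id_minus[OF S]
  note Ak = bounded_clinearD[OF bounded_clinear_funpow[OF A]]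
  have Gmono: "(?A ^^ (j + k)) x = 0" if "(?A ^^ k) x = 0" for j k x
    using that Ak(5) by (simp add: funpow_add)
  have Gsub: "complex_vector.subspace ?G"
    unfolding complex_vector.subspace_def
  proof (intro conjI ballI allI)
    show "0 \<in> ?G" using Ak(5) by blast
  next
    fix x y assume "x \<in> ?G" "y \<in> ?G"
    then obtain j k where "(?A ^^ j) x = 0" "(?A ^^ k) y = 0" by blast
    then have "(?A ^^ (k + j)) (x + y) = 0"
      using Gmono[of j x k] Gmono[of k y j] by (simp only: Ak(2) add.commute[of k j]) simp
    then show "x + y \<in> ?G" by blast
  next
    fix c x assume "x \<in> ?G"
    then show "c *\<^sub>C x \<in> ?G" using Ak(4) by force
  qed
  let ?P = "\<lambda>X. finite X \<and> X \<subseteq> ?G \<and> ?A ` ?span X \<subseteq> ?span X"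
  have step: "\<exists>Y. ?P Y \<and> (?span X \<subset> ?span Y \<and> ?A ` ?span Y \<subseteq> ?span X)" if X: "?P X" for X
  proof -
    have "?span X \<subseteq> ?G" using X Gsub by (intro complex_vector.span_minimal) auto
    moreover have "?span X \<noteq> ?G" using inf X unfolding cfinite_dim_def by blast
    ultimately obtain y k where y: "y \<notin> ?span X" "(?A ^^ k) y = 0" by blast
    then have ex: "\<exists>k. (?A ^^ k) y \<in> ?span X" using complex_vector.span_zero by metis
    \<comment> \<open>The iterates of \<open>y\<close> start outside the span and eventually enter
      it. The last one outside is the vector to adjoin: \<open>?A\<close> sends it into the old
      span.\<close>
    define j where "j = (LEAST k. (?A ^^ k) y \<in> ?span X)"
    have j: "(?A ^^ j) y \<in> ?span X" unfolding j_def using ex by (rule LeastI_ex)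
    with y obtain i where i: "j = Suc i" by (cases j) auto
    define x where "x = (?A ^^ i) y"
    have xn: "x \<notin> ?span X" unfolding x_def using not_less_Least[of i "\<lambda>k. (?A ^^ k) y \<in> ?span X"] i j_def by simp
    have Ax: "?A x \<in> ?span X" using j i by (simp add: x_def)
    have "(?A ^^ (i + k)) y = 0" by (rule Gmono[OF y(2)])
    then have "(?A ^^ k) x = 0" by (simp add: x_def funpow_add[symmetric, THEN fun_cong, unfolded comp_apply] add.commute)
    then have xG: "x \<in> ?G" by blast
    have A1: "?A ` ?span (insert x X) \<subseteq> ?span X"
    proof
      fix w assume "w \<in> ?A ` ?span (insert x X)"
      then obtain u c where u: "u - c *\<^sub>C x \<in> ?span X" "w = ?A u"
        by (auto simp: complex_vector.span_insert)
      have "w = ?A (u - c *\<^sub>C x) + c *\<^sub>C ?A x"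
        using u(2) bounded_clinearD(3)[OF A, of u "c *\<^sub>C x"] bounded_clinearD(4)[OF A, of c x] by simp
      moreover have "?A (u - c *\<^sub>C x) \<in> ?span X" using X u(1) by blast
      ultimately show "w \<in> ?span X"
        using complex_vector.span_add complex_vector.span_scale[OF Ax] by metis
    qed
    have mono: "?span X \<subseteq> ?span (insert x X)" by (intro complex_vector.span_mono) auto
    moreover have "x \<in> ?span (insert x X)" by (intro complex_vector.span_base) simp
    ultimately have "?span X \<subset> ?span (insert x X)" using xn by auto
    then show ?thesis
      using X xG A1 mono by (intro exI[of _ "insert x X"]) auto
  qed
  let ?R = "\<lambda>X Y. ?span X \<subset> ?span Y \<and> ?A ` ?span Y \<subseteq> ?span X"
  have "\<exists>X. \<forall>k. ?P (X k) \<and> ?R (X k) (X (Suc k))"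
  proof (rule dependent_nat_choice[of "\<lambda>_. ?P" "\<lambda>_. ?R"])
    have "?P {}" by (simp add: bounded_clinearD(5)[OF S])
    then show "\<exists>X. ?P X" by blast
  qed (rule step)
  then obtain X where X': "\<forall>k. ?P (X k) \<and> ?R (X k) (X (Suc k))" ..
  have X: "finite (X k)" "?A ` ?span (X k) \<subseteq> ?span (X k)"
    "?span (X k) \<subset> ?span (X (Suc k))" "?A ` ?span (X (Suc k)) \<subseteq> ?span (X k)" for k
    using spec[OF X', of k] by simp_all
  have inc: "?span (X k) \<subseteq> ?span (X l)" if "k \<le> l" for k l
    by (rule lift_Suc_mono_le[of "\<lambda>k. ?span (X k)", OF psubset_imp_subset[OF X(3)] that])
  have inv: "S ` ?span (X k) \<subseteq> ?span (X k)" for k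
  proof
    fix x assume "x \<in> S ` ?span (X k)"
    then obtain u where u: "u \<in> ?span (X k)" "x = S u" by blast
    have "u - S u \<in> ?span (X k)" using X(2)[of k] u(1) by blast
    then have "u - (u - S u) \<in> ?span (X k)" using complex_vector.span_diff u by blast
    then show "x \<in> ?span (X k)" using u by simp
  qed
  note sub = complex_vector.subspace_span
  show False
  proof (rule compact_map_no_infinite_flag[OF compact_power, of "\<lambda>k. ?span (X k)" "\<lambda>k. ?span (X (Suc k))" "\<lambda>_. 1" 1])
    fix k u assume u: "u \<in> ?span (X (Suc k))"
    \<comment> \<open>\<open>?A u\<close> already lies in the smaller span, and the cofactor
      preserves that span.\<close>
    have "- neumann_sum S m (u - S u) \<in> ?span (X k)"
      by (intro complex_vector.span_neg neumann_invariant(2) sub inv) (use X(4)[of k] u in blast)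
    then show "(S ^^ m) u - 1 *\<^sub>C u \<in> ?span (X k)"
      unfolding neumann_left by (simp add: scaleC_one)
  next
    fix k l :: nat assume "k \<noteq> l"
    have *: "(S ^^ m) ` ?span (X (Suc k)) \<subseteq> ?span (X l)" if "k < l" for k l
      using neumann_invariant(1)[OF sub inv, of _ "Suc k" m] inc[of "Suc k" l] that by auto
    show "(S ^^ m) ` ?span (X (Suc k)) \<subseteq> ?span (X l) \<or> (S ^^ m) ` ?span (X (Suc l)) \<subseteq> ?span (X k)"
      using *[of k l] *[of l k] \<open>k \<noteq> l\<close> nat_neq_iff[of k l] by blast
  qed (rule sub closed_span_finite X | simp)+
qed

text \<open>Infinitely many such eigenvalues would give a flag of spans of the first
  \<open>k\<close> eigenvectors, on whose quotients \<open>S ^^ m\<close> acts as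
  \<open>\<nu> k ^ m\<close>, of modulus at least \<open>\<delta> ^ m\<close>.\<close>

lemma finite_large_eigenvalues:
  assumes \<delta>: "\<delta> > 0"
  shows "finite {\<nu>. \<delta> \<le> cmod \<nu> \<and> (\<exists>x. x \<noteq> 0 \<and> S x = \<nu> *\<^sub>C x)}" (is "finite ?E")
proof (rule ccontr)
  let ?span = complex_vector.span
  assume "infinite ?E"
  then obtain \<nu> :: "nat \<Rightarrow> complex" where \<nu>: "inj \<nu>" "range \<nu> \<subseteq> ?E"
    using infinite_countable_subset[OF \<open>infinite ?E\<close>] by blast
  then have "\<forall>k. \<exists>x. x \<noteq> 0 \<and> S x = \<nu> k *\<^sub>C x" by blast
  then obtain x where x: "\<And>k. x k \<noteq> 0" "\<And>k. S (x k) = \<nu> k *\<^sub>C x k" by metis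
  define V where "V k = ?span (x ` {..<k})" for k
  have VSuc: "V (Suc k) = {u. \<exists>c. u - c *\<^sub>C x k \<in> V k}" for k
    by (simp add: V_def lessThan_Suc complex_vector.span_insert)
  have sub: "complex_vector.subspace (V k)" for k by (simp add: V_def)
  have inc: "V k \<subseteq> V l" if "k \<le> l" for k l
    unfolding V_def by (intro complex_vector.span_mono image_mono) (use that in auto)
  have inv: "S ` V k \<subseteq> V k" for k
  proof (induction k)
    case 0
    then show ?case by (simp add: V_def bounded_clinearD(5)[OF S])
  next
    case (Suc k)
    show ?case
    proof
      fix w assume "w \<in> S ` V (Suc k)"
      then obtain u c where u: "u - c *\<^sub>C x k \<in> V k" "w = S u" by (auto simp: VSuc)
      have "w - (c * \<nu> k) *\<^sub>C x k = S (u - c *\<^sub>C x k)"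
        by (simp add: u(2) bounded_clinearD(3,4)[OF S] x(2) scaleC_scaleC)
      then have "w - (c * \<nu> k) *\<^sub>C x k \<in> V k" using u(1) Suc by auto
      then show "w \<in> V (Suc k)" unfolding VSuc by blast
    qed
  qed
  \<comment> \<open>Stated for all later \<open>k\<close> at once: the induction step needs
    \<open>x k\<close> outside \<open>V j\<close> to know that \<open>a\<close> is nonzero. Applying
    \<open>\<nu> k - S\<close> to \<open>x k - a x j\<close> removes \<open>x k\<close> and leaves a
    nonzero multiple of \<open>x j\<close> in \<open>V j\<close>.\<close>
  have indep: "\<forall>k\<ge>j. x k \<notin> V j" for j
  proof (induction j)
    case 0
    then show ?case using x(1) by (simp add: V_def)
  next
    case (Suc j)
    show ?case
    proof (intro allI impI notI)
      fix k assume k: "Suc j \<le> k" and "x k \<in> V (Suc j)"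
      then obtain a where a: "x k - a *\<^sub>C x j \<in> V j" by (auto simp: VSuc)
      let ?w = "x k - a *\<^sub>C x j"
      have "\<nu> k *\<^sub>C ?w - S ?w = (a * (\<nu> j - \<nu> k)) *\<^sub>C x j"
        by (simp add: bounded_clinearD(3,4)[OF S] x(2) scaleC_scaleC algebra_simps
            complex_vector.scale_right_diff_distrib complex_vector.scale_left_diff_distrib)
      moreover have "\<nu> k *\<^sub>C ?w - S ?w \<in> V j"
        by (rule complex_vector.subspace_diff[OF sub complex_vector.subspace_scale[OF sub a]])
          (use inv[of j] a in blast)
      ultimately have "(a * (\<nu> j - \<nu> k)) *\<^sub>C x j \<in> V j" by simp
      moreover have "\<nu> j - \<nu> k \<noteq> 0" using \<nu>(1) k by (auto dest: injD)
      moreover have "a \<noteq> 0" using a Suc k by auto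
      ultimately have "x j \<in> V j"
        using complex_vector.subspace_scale[OF sub, of "(a * (\<nu> j - \<nu> k)) *\<^sub>C x j" j "1 / (a * (\<nu> j - \<nu> k))"]
        by (simp add: scaleC_scaleC scaleC_one)
      then show False using Suc by simp
    qed
  qed
  \<comment> \<open>The next difference is \<open>S\<close> of the current one plus
    \<open>\<nu> k ^ i\<close> times \<open>S u - \<nu> k u\<close>; invariance of
    \<open>V k\<close> treats the first term, the eigenvector equation the second.\<close>
  have diag: "(S ^^ i) u - (\<nu> k ^ i) *\<^sub>C u \<in> V k" if u: "u \<in> V (Suc k)" for i k u
  proof (induction i)
    case 0
    then show ?case using complex_vector.subspace_0[OF sub] by (simp add: scaleC_one)
  next
    case (Suc i)
    from u obtain c where c: "u - c *\<^sub>C x k \<in> V k" by (auto simp: VSuc)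
    have "S (u - c *\<^sub>C x k) - \<nu> k *\<^sub>C (u - c *\<^sub>C x k) \<in> V k"
      by (rule complex_vector.subspace_diff[OF sub _ complex_vector.subspace_scale[OF sub c]])
        (use inv[of k] c in blast)
    then have "S u - \<nu> k *\<^sub>C u \<in> V k"
      by (simp add: bounded_clinearD(3,4)[OF S] x(2) scaleC_scaleC
          complex_vector.scale_right_diff_distrib mult.commute)
    moreover have "S ((S ^^ i) u - (\<nu> k ^ i) *\<^sub>C u) \<in> V k" using inv[of k] Suc by blast
    ultimately have "S ((S ^^ i) u - (\<nu> k ^ i) *\<^sub>C u) + (\<nu> k ^ i) *\<^sub>C (S u - \<nu> k *\<^sub>C u) \<in> V k"
      by (intro complex_vector.subspace_add complex_vector.subspace_scale sub)
    then show ?case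
      by (simp add: bounded_clinearD(3,4)[OF S] scaleC_scaleC
          complex_vector.scale_right_diff_distrib mult.commute)
  qed
  show False
  proof (rule compact_map_no_infinite_flag[OF compact_power, of V "\<lambda>k. V (Suc k)" "\<lambda>k. \<nu> k ^ m" "\<delta> ^ m"])
    fix k
    have "x k \<in> V (Suc k)" unfolding V_def by (intro complex_vector.span_base) auto
    then show "V k \<subset> V (Suc k)" using indep[of k] inc[of k "Suc k"] by auto
    show "\<delta> ^ m \<le> cmod (\<nu> k ^ m)"
      using \<nu>(2) \<delta> by (auto simp: norm_power intro!: power_mono)
    show "closed (V k)" unfolding V_def by (intro closed_span_finite) auto
  next
    fix k l :: nat assume "k \<noteq> l"
    have *: "(S ^^ m) ` V (Suc k) \<subseteq> V l" if "k < l" for k l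
      using neumann_invariant(1)[OF sub inv, of _ "Suc k" m] inc[of "Suc k" l] that by auto
    show "(S ^^ m) ` V (Suc k) \<subseteq> V l \<or> (S ^^ m) ` V (Suc l) \<subseteq> V k"
      using *[of k l] *[of l k] \<open>k \<noteq> l\<close> nat_neq_iff[of k l] by blast
  qed (use sub diag \<delta> in auto)
qed

end

section \<open>Powers of multiples and bounded inverses\<close>

lemma funpow_scaleC:
  assumes "bounded_clinear R"
  shows "((\<lambda>x. c *\<^sub>C R x) ^^ i) x = (c ^ i) *\<^sub>C (R ^^ i) x"
  by (induction i) (simp_all add: scaleC_one bounded_clinearD(4)[OF assms] scaleC_scaleC)

text \<open>The lower bound provides both injectivity and the norm bound \<open>1 / e\<close> of the
  inverse.\<close>

lemma bounded_clinear_inverse: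
  assumes A: "bounded_clinear A" "surj A" and e: "e > 0" "\<And>x. e * norm x \<le> norm (A x)"
  shows "bounded_clinear (inv A)"
proof -
  have inj: "inj A"
  proof (rule injI)
    fix x y assume "A x = A y"
    then show "x = y" using e(2)[of "x - y"] e(1) bounded_clinearD(3)[OF A(1), of x y]
      by (simp add: mult_le_0_iff)
  qed
  have eq: "inv A y = x" if "A x = y" for x y using that inv_f_f[OF inj] by blast
  have AA: "A (inv A y) = y" for y by (rule surj_f_inv_f[OF A(2)])
  have add: "inv A (x + y) = inv A x + inv A y" for x y
    by (rule eq) (simp add: bounded_clinearD(2)[OF A(1)] AA)
  have scale: "inv A (c *\<^sub>C x) = c *\<^sub>C inv A x" for c x
    by (rule eq) (simp add: bounded_clinearD(4)[OF A(1)] AA)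
  have "norm (inv A x) \<le> norm x * (1 / e)" for x
    using e(2)[of "inv A x"] e(1) by (simp add: AA field_simps)
  then have "bounded_linear (inv A)"
    by (intro bounded_linear_intro[of _ "1 / e"]) (simp_all only: add scale scaleR_scaleC)
  then show ?thesis using scale by (simp add: bounded_clinear_def)
qed

section \<open>Operators with power compact resolvent\<close>

context
  fixes D :: "'a::complex_hilbert_space set" and B :: "'a \<Rightarrow> 'a" and \<mu> :: complex and n :: nat
  assumes \<mu>: "\<mu> \<in> resolvent_set D B"
    and compact_power: "compact_map_on UNIV (resolvent D B \<mu> ^^ n)"
begin

lemma resolvent_clinear: "bounded_clinear (resolvent D B \<mu>)"
  and resolvent_in: "resolvent D B \<mu> y \<in> D"
  and shift_resolvent: "shift B \<mu> (resolvent D B \<mu> y) = y"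
  and resolvent_shift: "x \<in> D \<Longrightarrow> resolvent D B \<mu> (shift B \<mu> x) = x"
proof -
  have bij: "bij_betw (shift B \<mu>) D UNIV" and "bounded_clinear (resolvent D B \<mu>)"
    using \<mu> by (auto simp: resolvent_set_def)
  then show "bounded_clinear (resolvent D B \<mu>)" by blast
  show "resolvent D B \<mu> y \<in> D"
    using bij by (auto simp: resolvent_def bij_betw_def intro!: inv_into_into)
  show "shift B \<mu> (resolvent D B \<mu> y) = y"
    using bij by (auto simp: resolvent_def bij_betw_def intro!: f_inv_into_f)
  show "resolvent D B \<mu> (shift B \<mu> x) = x" if "x \<in> D"
    using bij that by (auto simp: resolvent_def bij_betw_def)
qed

text \<open>Supplies the hypotheses of the Riesz theory for \<open>S\<close> equal to a multiple of
  the resolvent.\<close>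

lemma scaled_resolvent:
  shows "bounded_clinear (\<lambda>x. c *\<^sub>C resolvent D B \<mu> x)"
    and "compact_map_on UNIV ((\<lambda>x. c *\<^sub>C resolvent D B \<mu> x) ^^ n)"
proof -
  show "bounded_clinear (\<lambda>x. c *\<^sub>C resolvent D B \<mu> x)"
    by (rule bounded_clinear_scaleC[OF resolvent_clinear])
  show "compact_map_on UNIV ((\<lambda>x. c *\<^sub>C resolvent D B \<mu> x) ^^ n)"
    using bounded_compose_compact_map_on[OF compact_power bounded_linear_scaleC_right[of "c ^ n"]]
    unfolding funpow_scaleC[OF resolvent_clinear, THEN ext] .
qed

lemma shift_eq:
  "shift B \<tau> x = shift B \<mu> x - (\<tau> - \<mu>) *\<^sub>C x"
  by (simp add: shift_def complex_vector.scale_left_diff_distrib)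

text \<open>With \<open>R\<close> the resolvent at \<mu>, \<open>(B - \<tau>) R\<close> equals
  \<open>I - (\<tau> - \<mu>) R\<close>. A nonzero vector \<open>y\<close> in the kernel of the
  latter gives the eigenvector \<open>R y\<close>; without one, the Fredholm alternative inverts it,
  and \<open>R\<close> after that inverse is a bounded resolvent at \<tau>.\<close>

lemma spectrum_eigenvalue:
  assumes "\<tau> \<in> spectrum D B"
  shows "eigenvalue D B \<tau>"
proof (rule ccontr)
  assume not: "\<not> ?thesis"
  let ?R = "resolvent D B \<mu>"
  define A where "A = (\<lambda>x. x - (\<tau> - \<mu>) *\<^sub>C ?R x)"
  have A: "bounded_clinear A" unfolding A_def by (rule bounded_clinear_id_minus[OF scaled_resolvent(1)])
  have inj0: "y = 0" if y: "(\<tau> - \<mu>) *\<^sub>C ?R y = y" for y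
  proof (rule ccontr)
    assume "y \<noteq> 0"
    then have "?R y \<noteq> 0" using y by auto
    moreover have "B (?R y) = \<tau> *\<^sub>C ?R y"
      using shift_resolvent[of y] y unfolding shift_def
      by (simp add: complex_vector.scale_left_diff_distrib diff_eq_eq)
    ultimately show False using not resolvent_in unfolding eigenvalue_def by blast
  qed
  have surj: "surj A"
    unfolding A_def by (rule Fredholm_alternative[OF scaled_resolvent inj0])
  obtain e where e: "e > 0" "\<And>x. e * norm x \<le> norm (A x)"
    unfolding A_def using id_minus_bounded_below[OF scaled_resolvent inj0] by blast
  have invA: "bounded_clinear (inv A)" by (rule bounded_clinear_inverse[OF A surj e])
  have injA: "x = 0" if "A x = 0" for x
    using that unfolding A_def by (intro inj0) (rule sym, rule eq_iff_diff_eq_0[THEN iffD2])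
  have shift_R: "shift B \<tau> (?R y) = A y" for y
    unfolding shift_eq[of \<tau>] shift_resolvent A_def ..
  have inj: "inj_on (shift B \<tau>) D"
  proof (rule inj_onI)
    fix x y assume xy: "x \<in> D" "y \<in> D" "shift B \<tau> x = shift B \<tau> y"
    then have "A (shift B \<mu> x) = A (shift B \<mu> y)"
      unfolding shift_R[symmetric] by (simp add: resolvent_shift)
    then have "shift B \<mu> x = shift B \<mu> y"
      using injA[of "shift B \<mu> x - shift B \<mu> y"] by (simp add: bounded_clinearD(3)[OF A])
    then show "x = y" using xy resolvent_shift by metis
  qed
  have res: "shift B \<tau> (?R (inv A y)) = y" for y
    unfolding shift_R by (rule surj_f_inv_f[OF surj])
  have "bij_betw (shift B \<tau>) D UNIV"
    using inj res resolvent_in unfolding bij_betw_def by (metis UNIV_eq_I imageI)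
  moreover have "resolvent D B \<tau> = (\<lambda>y. ?R (inv A y))"
    unfolding resolvent_def[of D B \<tau>] by (intro ext inv_into_f_eq[OF inj] resolvent_in res)
  moreover have "bounded_clinear (\<lambda>y. ?R (inv A y))"
    using invA resolvent_clinear bounded_linear_compose[of ?R "inv A"] by (simp add: bounded_clinear_def)
  ultimately have "\<tau> \<in> resolvent_set D B" by (simp add: resolvent_set_def)
  then show False using assms by (simp add: spectrum_def)
qed

text \<open>On \<open>D\<close>, applying the resolvent to \<open>(B - \<tau>) x\<close> gives
  \<open>x - (\<tau> - \<mu>) R x\<close>. As the resolvent is injective and commutes with this
  bounded operator, kernels of powers correspond, and the Riesz theory applies to the unbounded
  operator.\<close>

lemma ker_power_eq:
  "ker_power D B \<tau> k = {x. ((\<lambda>x. x - (\<tau> - \<mu>) *\<^sub>C resolvent D B \<mu> x) ^^ k) x = 0}"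
proof -
  let ?R = "resolvent D B \<mu>"
  let ?A = "\<lambda>x. x - (\<tau> - \<mu>) *\<^sub>C ?R x"
  note R = bounded_clinearD[OF resolvent_clinear]
  have comm: "(?A ^^ k) (?R y) = ?R ((?A ^^ k) y)" for k y
    by (induction k) (simp_all add: R)
  have RA: "?R (shift B \<tau> x) = ?A x" if "x \<in> D" for x
    using that by (simp add: shift_eq[of \<tau>] R resolvent_shift)
  have Rinj: "?R y = 0 \<longleftrightarrow> y = 0" for y
    using shift_resolvent[of y] shift_resolvent[of 0] R(5) by auto
  \<comment> \<open>The domain conditions come for free: \<open>x\<close> is \<open>?A x\<close>
    plus a multiple of \<open>?R x\<close>, so it lies in \<open>D\<close> as soon as
    \<open>?A x\<close> does.\<close>
  have inD: "x \<in> D" if "(?A ^^ k) x = 0" for k x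
    using that
  proof (induction k arbitrary: x)
    case 0
    then show ?case using resolvent_in[of 0] R(5) by simp
  next
    case (Suc k)
    then have "(?A ^^ k) (?A x) = 0" by (simp only: funpow_Suc_right comp_apply)
    then have "?A x \<in> D" by (rule Suc.IH)
    then have "x = ?R (shift B \<mu> (?A x) + (\<tau> - \<mu>) *\<^sub>C x)" by (simp add: R resolvent_shift)
    then show ?case using resolvent_in by metis
  qed
  have "x \<in> ker_power D B \<tau> k \<longleftrightarrow> (?A ^^ k) x = 0" for x
  proof (induction k arbitrary: x)
    case 0
    then show ?case by (simp add: ker_power_def)
  next
    case (Suc k)
    \<comment> \<open>The innermost factor is split off, so the domain condition for
      \<open>i = 0\<close> becomes \<open>x \<in> D\<close> and the others refer to
      \<open>shift B \<tau> x\<close>.\<close>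
    have "x \<in> ker_power D B \<tau> (Suc k) \<longleftrightarrow> x \<in> D \<and> shift B \<tau> x \<in> ker_power D B \<tau> k"
      unfolding ker_power_def by (simp add: All_less_Suc2 funpow_Suc_right del: funpow.simps)
    also have "\<dots> \<longleftrightarrow> x \<in> D \<and> ?R ((?A ^^ k) (shift B \<tau> x)) = 0"
      by (simp only: Suc.IH Rinj)
    also have "\<dots> \<longleftrightarrow> x \<in> D \<and> (?A ^^ Suc k) x = 0"
      unfolding comm[symmetric] using RA by (simp only: funpow_Suc_right comp_apply cong: conj_cong)
    also have "\<dots> \<longleftrightarrow> (?A ^^ Suc k) x = 0" using inD by blast
    finally show ?case .
  qed
  then show ?thesis by blast
qed

lemma generalized_eigenspace_finite_dim: "cfinite_dim (generalized_eigenspace D B \<tau>)"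
proof -
  let ?A = "\<lambda>x. x - (\<tau> - \<mu>) *\<^sub>C resolvent D B \<mu> x"
  have "generalized_eigenspace D B \<tau> = {x. \<exists>k. (?A ^^ k) x = 0}"
  proof (intro set_eqI iffI)
    fix x assume "x \<in> {x. \<exists>k. (?A ^^ k) x = 0}"
    then obtain k where "(?A ^^ k) x = 0" by blast
    \<comment> \<open>Eigenspace exponents start at 1, so one more application of \<open>?A\<close>
      covers the case \<open>k = 0\<close>.\<close>
    then have "(?A ^^ Suc k) x = 0" using bounded_clinearD(5)[OF resolvent_clinear] by simp
    then show "x \<in> generalized_eigenspace D B \<tau>"
      unfolding generalized_eigenspace_def ker_power_eq by (intro UN_I[of "Suc k"]) auto
  qed (auto simp: generalized_eigenspace_def ker_power_eq)
  then show ?thesis using generalized_kernel_finite_dim[OF scaled_resolvent] by simp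
qed

text \<open>The map sending \<tau> to \<open>1 / (\<tau> - \<mu>)\<close> injects the part of the
  spectrum near \<open>z\<close> into the eigenvalues of the resolvent bounded away from 0, which
  are finitely many.\<close>

lemma spectrum_no_limit_point: "\<not> z islimpt spectrum D B"
proof
  assume "z islimpt spectrum D B"
  then have inf: "infinite (spectrum D B \<inter> ball z 1)" by (simp add: islimpt_eq_infinite_ball)
  let ?R = "resolvent D B \<mu>"
  \<comment> \<open>On the unit ball around \<open>z\<close> the distance to \<mu> is at most the
    denominator.\<close>
  let ?\<delta> = "1 / (cmod (z - \<mu>) + 1)"
  let ?E = "{\<nu>. ?\<delta> \<le> cmod \<nu> \<and> (\<exists>x. x \<noteq> 0 \<and> ?R x = \<nu> *\<^sub>C x)}"
  have pos: "cmod (z - \<mu>) + 1 > 0" using norm_ge_zero[of "z - \<mu>"] by linarith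
  have "(\<lambda>\<tau>. 1 / (\<tau> - \<mu>)) ` (spectrum D B \<inter> ball z 1) \<subseteq> ?E"
  proof (rule image_subsetI)
    fix \<tau> assume \<tau>: "\<tau> \<in> spectrum D B \<inter> ball z 1"
    then obtain x where x: "x \<in> D" "x \<noteq> 0" "B x = \<tau> *\<^sub>C x"
      using spectrum_eigenvalue unfolding eigenvalue_def by blast
    have ne: "\<tau> - \<mu> \<noteq> 0" using \<tau> \<mu> by (auto simp: spectrum_def)
    have "shift B \<mu> x = (\<tau> - \<mu>) *\<^sub>C x"
      by (simp add: shift_def x(3) complex_vector.scale_left_diff_distrib)
    then have "x = (\<tau> - \<mu>) *\<^sub>C ?R x"
      using resolvent_shift[OF x(1)] bounded_clinearD(4)[OF resolvent_clinear] by metis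
    then have "(1 / (\<tau> - \<mu>)) *\<^sub>C x = (1 / (\<tau> - \<mu>)) *\<^sub>C ((\<tau> - \<mu>) *\<^sub>C ?R x)" by simp
    then have "?R x = (1 / (\<tau> - \<mu>)) *\<^sub>C x" using ne by (simp add: scaleC_scaleC scaleC_one)
    moreover have "cmod (\<tau> - \<mu>) \<le> cmod (z - \<mu>) + 1"
      using \<tau> norm_triangle_ineq[of "z - \<mu>" "\<tau> - z"] by (auto simp: dist_norm norm_minus_commute)
    then have "?\<delta> \<le> cmod (1 / (\<tau> - \<mu>))"
      unfolding norm_divide norm_one using ne pos by (intro divide_left_mono) auto
    ultimately show "1 / (\<tau> - \<mu>) \<in> ?E" using x(2) by blast
  qed
  moreover have "finite ?E"
    using finite_large_eigenvalues[OF resolvent_clinear compact_power] pos by simp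
  ultimately have "finite ((\<lambda>\<tau>. 1 / (\<tau> - \<mu>)) ` (spectrum D B \<inter> ball z 1))" by (rule finite_subset)
  moreover have "inj_on (\<lambda>\<tau>. 1 / (\<tau> - \<mu>)) (spectrum D B \<inter> ball z 1)"
    by (auto simp: inj_on_def)
  ultimately show False using inf finite_image_iff by blast
qed

end

theorem theorem15:
  fixes D :: "'a::complex_hilbert_space set"
    and B :: "'a \<Rightarrow> 'a"
    and \<mu> :: complex
  assumes "\<not> cfinite_dim (UNIV :: 'a set)"
    and "linear_operator D B"
    and "closed_operator D B"
    and "densely_defined D"
    and "\<mu> \<in> resolvent_set D B"
    and "\<exists>n H. upper_triangular_compact n H (resolvent D B \<mu>)"
  shows "(\<forall>\<tau>\<in>spectrum D B. eigenvalue D B \<tau> \<and> cfinite_dim (generalized_eigenspace D B \<tau>)) \<and>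
         (\<forall>z. \<not> z islimpt spectrum D B)"
proof -
  obtain n where "compact_map_on UNIV (resolvent D B \<mu> ^^ n)"
    using assms(6) upper_triangular_compact_power by blast
  then show ?thesis
    using assms(5) spectrum_eigenvalue generalized_eigenspace_finite_dim spectrum_no_limit_point
    by blast
qed

end
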